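(* The minimal unavoidable sets of length two are precisely the sets $O_1,O_2,\dots,O_9$ and their reversals, where \begin{align*} O_1 &= \{(1,1), (1,2),(2,1),(1,3)\},\\ O_2 &= \{(1,1), (1,2),(2,2),(1,3),(1,4)\},\\ O_3 &= \{(1,1),(1,2),(2,2),(1,3),(4,1),(4,2)\},\\ O_4 &=\{(1,1), (1,2),(2,2),(3,1),(3,2),(4,1),(4,2),(1,5)\},\\ O_5 &=\{(1,1), (1,2),(2,2),(3,1),(3,2),(4,1),(4,2),(5,2)\},\\ O_6 &=\{(1,1), (1,2),(2,2),(3,1),(3,2),(1,4),(4,2),(1,5)\},\\ O_7 &=\{(1,1), (1,2),(2,2),(3,1),(3,2),(1,4),(4,2),(5,2)\},\\ O_8 &=\{(1,1), (1,2),(2,2),(3,1),(3,2), (1,4),(3,4),(1,5)\},\\ O_9 &=\{(1,1), (1,2),(2,2),(3,1),(3,2), (1,4),(3,4),(5,2)\}. \end{align*}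
   Context: A triangulated polygon is a polygon with at least three vertices, divided into triangles by pairwise non-crossing diagonals. Label each vertex by the number of triangles incident to it. A quiddity sequence is the finite sequence of all these labels, read clockwise around the polygon starting from any vertex. A trimmed quiddity sequence is a word obtained by removing the last entry of a quiddity sequence. For example, $(1,2,1,2)$ is a quiddity sequence (of a triangulated quadrilateral) and $(1,2,1)$ is a trimmed quiddity sequence. A word is a nonempty finite sequence. A word $x$ is a substring of a word $(b_0,\dots,b_m)$ if $x=(b_r,b_{r+1},\dots,b_s)$ for some $0\leq r\leq s\leq m$. A set $X$ of words is without redundancy if no element of $X$ is a substring of another element of $X$. The reversal of $X$ is the set obtained by reversing each word of $X$. A finite set $X$ of words of positive integers, without redundancy, is an unavoidable set if each trimmed quiddity sequence has a substring that belongs to $X$. The length of $X$ is the supremum of the lengths of its words. Finite unavoidable sets are partially ordered by $X\preceq Y$ iff every $x\in X$ contains some $y\in Y$ as a substring. A minimal unavoidable set of length $L$ is a minimal element of the poset of finite unavoidable sets of length $L$. *)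

theory Defs
  imports "HOL-Library.Sublist"
begin

text \<open>
  The vertices of the \<open>n\<close>-gon are \<open>0, \<dots>, n - 1\<close> in clockwise order; a diagonal is represented by
  the pair of its end points, the smaller one first.
\<close>

definition diagonals :: "nat \<Rightarrow> (nat \<times> nat) set" where
  "diagonals n = {(i, j). i + 1 < j \<and> j < n \<and> (i, j) \<noteq> (0, n - 1)}"

definition sides :: "nat \<Rightarrow> (nat \<times> nat) set" where
  "sides n = {(i, i + 1) | i. i + 1 < n} \<union> {(0, n - 1)}"

fun crossing :: "nat \<times> nat \<Rightarrow> nat \<times> nat \<Rightarrow> bool" where
  "crossing (i, j) (k, l) \<longleftrightarrow> (i < k \<and> k < j \<and> j < l) \<or> (k < i \<and> i < l \<and> l < j)"

definition noncrossing_diagonals :: "nat \<Rightarrow> (nat \<times> nat) set \<Rightarrow> bool" where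
  "noncrossing_diagonals n D \<longleftrightarrow>
     D \<subseteq> diagonals n \<and> (\<forall>d\<in>D. \<forall>e\<in>D. \<not> crossing d e)"

text \<open>
  For \<open>i < j\<close> in \<open>S\<close>: \<open>i\<close> and \<open>j\<close> are neighbours in the cyclic order that \<open>S\<close> inherits from
  the polygon, i.e. one of the two open arcs between them contains no element of \<open>S\<close>.
\<close>

definition cyclically_consecutive :: "nat set \<Rightarrow> nat \<Rightarrow> nat \<Rightarrow> bool" where
  "cyclically_consecutive S i j \<longleftrightarrow>
     (\<forall>k\<in>S. \<not> (i < k \<and> k < j)) \<or> (\<forall>k\<in>S. \<not> (k < i \<or> j < k))"

text \<open>
  The regions into which pairwise non-crossing diagonals \<open>D\<close> divide the \<open>n\<close>-gon, each given by
  its set \<open>S\<close> of vertices: the boundary edges of the region are sides or elements of \<open>D\<close>, and no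
  element of \<open>D\<close> cuts through the region.
\<close>

definition regions :: "nat \<Rightarrow> (nat \<times> nat) set \<Rightarrow> nat set set" where
  "regions n D = {S. S \<subseteq> {..<n} \<and> card S \<ge> 3 \<and>
     (\<forall>i\<in>S. \<forall>j\<in>S. i < j \<longrightarrow> ((i, j) \<in> sides n \<union> D \<longleftrightarrow> cyclically_consecutive S i j))}"

definition triangulated_polygon :: "nat \<Rightarrow> (nat \<times> nat) set \<Rightarrow> bool" where
  "triangulated_polygon n D \<longleftrightarrow>
     n \<ge> 3 \<and> noncrossing_diagonals n D \<and> (\<forall>S\<in>regions n D. card S = 3)"

definition vertex_label :: "nat \<Rightarrow> (nat \<times> nat) set \<Rightarrow> nat \<Rightarrow> nat" where
  "vertex_label n D v = card {S \<in> regions n D. v \<in> S}"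

definition quiddity_sequence :: "nat list \<Rightarrow> bool" where
  "quiddity_sequence q \<longleftrightarrow>
     (\<exists>n D s. triangulated_polygon n D \<and> q = rotate s (map (vertex_label n D) [0..<n]))"

definition trimmed_quiddity_sequence :: "nat list \<Rightarrow> bool" where
  "trimmed_quiddity_sequence t \<longleftrightarrow> (\<exists>q. quiddity_sequence q \<and> t = butlast q)"

definition without_redundancy :: "nat list set \<Rightarrow> bool" where
  "without_redundancy X \<longleftrightarrow> (\<forall>x\<in>X. \<forall>y\<in>X. sublist x y \<longrightarrow> x = y)"

definition reversal :: "nat list set \<Rightarrow> nat list set" where
  "reversal X = rev ` X"

definition unavoidable_set :: "nat list set \<Rightarrow> bool" where
  "unavoidable_set X \<longleftrightarrow>
     finite X \<and> (\<forall>x\<in>X. x \<noteq> [] \<and> (\<forall>a\<in>set x. 0 < a)) \<and> without_redundancy X \<and>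
     (\<forall>t. trimmed_quiddity_sequence t \<longrightarrow> (\<exists>x\<in>X. sublist x t))"

text \<open>Only used for finite nonempty sets, for which the supremum in \<open>nat\<close> is the maximum.\<close>

definition set_length :: "nat list set \<Rightarrow> nat" where
  "set_length X = (SUP x\<in>X. length x)"

definition unavoidable_le :: "nat list set \<Rightarrow> nat list set \<Rightarrow> bool"  (infix \<open>\<preceq>\<close> 50) where
  "X \<preceq> Y \<longleftrightarrow> (\<forall>x\<in>X. \<exists>y\<in>Y. sublist y x)"

definition minimal_unavoidable_set :: "nat \<Rightarrow> nat list set \<Rightarrow> bool" where
  "minimal_unavoidable_set L X \<longleftrightarrow>
     unavoidable_set X \<and> set_length X = L \<and>
     (\<forall>Y. unavoidable_set Y \<and> set_length Y = L \<and> Y \<preceq> X \<longrightarrow> Y = X)"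

definition O1 :: "nat list set" where
  "O1 = {[1,1], [1,2], [2,1], [1,3]}"

definition O2 :: "nat list set" where
  "O2 = {[1,1], [1,2], [2,2], [1,3], [1,4]}"

definition O3 :: "nat list set" where
  "O3 = {[1,1], [1,2], [2,2], [1,3], [4,1], [4,2]}"

definition O4 :: "nat list set" where
  "O4 = {[1,1], [1,2], [2,2], [3,1], [3,2], [4,1], [4,2], [1,5]}"

definition O5 :: "nat list set" where
  "O5 = {[1,1], [1,2], [2,2], [3,1], [3,2], [4,1], [4,2], [5,2]}"

definition O6 :: "nat list set" where
  "O6 = {[1,1], [1,2], [2,2], [3,1], [3,2], [1,4], [4,2], [1,5]}"

definition O7 :: "nat list set" where
  "O7 = {[1,1], [1,2], [2,2], [3,1], [3,2], [1,4], [4,2], [5,2]}"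

definition O8 :: "nat list set" where
  "O8 = {[1,1], [1,2], [2,2], [3,1], [3,2], [1,4], [3,4], [1,5]}"

definition O9 :: "nat list set" where
  "O9 = {[1,1], [1,2], [2,2], [3,1], [3,2], [1,4], [3,4], [5,2]}"

end

theory Submission
  imports Defs Complex_Main
begin

text \<open>
  Every triangulation with at least four vertices has an ear, so quiddity sequences are what arises
  from \<open>(1,1,1)\<close> by replacing neighbours \<open>a, b\<close> with \<open>a+1, 1, b+1\<close>. By induction along ears, the
  continued fraction \<open>r\<^sub>1 = c\<^sub>1\<close>, \<open>r\<^sub>i = c\<^sub>i - 1/r\<^sub>i\<^sub>-\<^sub>1\<close> does not stay positive along a trimmed
  quiddity sequence. For each \<open>O\<^sub>k\<close> there are numbers \<open>l(c) > 0\<close> with \<open>d - 1/l(c) \<ge> l(d)\<close> whenever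
  \<open>(c,d)\<close> is not in \<open>O\<^sub>k\<close>, so a word avoiding \<open>O\<^sub>k\<close> keeps \<open>r\<^sub>i > l(c\<^sub>i) > 0\<close> and is not trimmed.
  Conversely, a few explicit trimmed quiddity sequences force every unavoidable set of length two to
  lie above some \<open>O\<^sub>k\<close> or its reversal; some of them contain one entry larger than all
  entries in the given finite set. Since the listed sets form an antichain, they are the minimal ones.
\<close>

section \<open>Triangulated polygons and ears\<close>

inductive ear_sequence :: "nat list \<Rightarrow> bool" where
  triangle: "ear_sequence [1, 1, 1]"
| ear: "ear_sequence (xs @ a # b # ys) \<Longrightarrow> ear_sequence (xs @ Suc a # 1 # Suc b # ys)"

text \<open>\<open>skip p\<close> renumbers the vertices when a new vertex \<open>p\<close> is inserted.\<close>

definition skip :: "nat \<Rightarrow> nat \<Rightarrow> nat" where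
  "skip p a = (if a < p then a else Suc a)"

text \<open>The old edge from \<open>p - 1\<close> to \<open>p\<close> becomes the diagonal under
  the new vertex. It is used with \<open>0 < p\<close> and \<open>p < n\<close>: this avoids ears at
  the vertices \<open>0\<close> and \<open>n\<close> of the larger polygon, so the pair
  \<open>(p - 1, Suc p)\<close> is always the right one.\<close>

definition add_ear :: "nat \<Rightarrow> (nat \<times> nat) set \<Rightarrow> (nat \<times> nat) set" where
  "add_ear p D = insert (p - 1, Suc p) (map_prod (skip p) (skip p) ` D)"

lemma skip_less_iff [simp]: "skip p a < skip p b \<longleftrightarrow> a < b"
  by (auto simp: skip_def)

lemma skip_eq_iff [simp]: "skip p a = skip p b \<longleftrightarrow> a = b"
  by (auto simp: skip_def)

lemma inj_skip: "inj (skip p)"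
  by (auto simp: inj_def)

lemma skip_neq [simp]: "skip p a \<noteq> p" "p \<noteq> skip p a"
  by (auto simp: skip_def)

lemma skip_surj: "a \<noteq> p \<Longrightarrow> \<exists>b. a = skip p b"
  by (rule exI[of _ "if a < p then a else a - 1"]) (auto simp: skip_def)

lemma skip_less_Suc_iff: "p < n \<Longrightarrow> skip p a < Suc n \<longleftrightarrow> a < n"
  by (auto simp: skip_def)

section \<open>Edges, crossings and regions after inserting an ear\<close>

text \<open>Sides and diagonals are transported together, because the old side
  \<open>(p - 1, p)\<close> turns into the new diagonal.\<close>

lemma add_ear_sides_iff:
  assumes "0 < p" "p < n" "n \<ge> 3" "a < b" "b < n" "D \<subseteq> diagonals n"
  shows "(skip p a, skip p b) \<in> sides (Suc n) \<union> add_ear p D \<longleftrightarrow> (a, b) \<in> sides n \<union> D"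
proof -
  have 1: "(skip p a, skip p b) \<in> map_prod (skip p) (skip p) ` D \<longleftrightarrow> (a, b) \<in> D"
    by (force simp: image_iff)
  have 2: "(skip p a, skip p b) \<in> insert (p - 1, Suc p) (sides (Suc n)) \<longleftrightarrow> (a, b) \<in> sides n"
    using assms(1-5) by (auto simp: sides_def skip_def)
  show ?thesis using 1 2 by (auto simp: add_ear_def)
qed

lemma add_ear_diagonals:
  assumes "0 < p" "p < n" "n \<ge> 3" "D \<subseteq> diagonals n"
  shows "add_ear p D \<subseteq> diagonals (Suc n)"
proof
  fix e assume "e \<in> add_ear p D"
  then consider "e = (p - 1, Suc p)" | a b where "(a, b) \<in> D" "e = (skip p a, skip p b)"
    by (auto simp: add_ear_def)
  then show "e \<in> diagonals (Suc n)"
  proof cases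
    case 1
    then show ?thesis using assms(1-3) by (auto simp: diagonals_def)
  next
    case 2
    then have "a + 1 < b" "b < n" "(a, b) \<noteq> (0, n - 1)" using assms(4) by (auto simp: diagonals_def)
    then show ?thesis using assms(1-3) 2(2) by (auto simp: diagonals_def skip_def)
  qed
qed

lemma crossing_skip [simp]:
  "crossing (map_prod (skip p) (skip p) d) (map_prod (skip p) (skip p) e) \<longleftrightarrow> crossing d e"
  by (cases d; cases e) simp

text \<open>The new diagonal separates only \<open>p\<close> from the other vertices, and no
  renumbered diagonal ends at \<open>p\<close>.\<close>

lemma not_crossing_ear:
  assumes "0 < p"
  shows "\<not> crossing (p - 1, Suc p) (map_prod (skip p) (skip p) d)"
        "\<not> crossing (map_prod (skip p) (skip p) d) (p - 1, Suc p)"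
  using assms by (cases d; auto simp: skip_def split: if_splits)+

lemma noncrossing_add_ear_iff:
  assumes "0 < p" "p < n" "n \<ge> 3" "D \<subseteq> diagonals n"
  shows "noncrossing_diagonals (Suc n) (add_ear p D) \<longleftrightarrow> noncrossing_diagonals n D"
proof -
  have "\<not> crossing (p - 1, Suc p) (p - 1, Suc p)" by simp
  then have "(\<forall>d\<in>add_ear p D. \<forall>e\<in>add_ear p D. \<not> crossing d e) \<longleftrightarrow> (\<forall>d\<in>D. \<forall>e\<in>D. \<not> crossing d e)"
    by (simp only: add_ear_def ball_simps crossing_skip not_crossing_ear[OF assms(1)] simp_thms) blast
  then show ?thesis
    using assms(4) add_ear_diagonals[OF assms] by (simp only: noncrossing_diagonals_def simp_thms)
qed

lemma cyclically_consecutive_skip [simp]: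
  "cyclically_consecutive (skip p ` S) (skip p a) (skip p b) \<longleftrightarrow> cyclically_consecutive S a b"
  by (simp add: cyclically_consecutive_def)

lemma ear_edges:
  assumes "0 < p" "p < n" "D \<subseteq> diagonals n"
  shows "(a, p) \<in> sides (Suc n) \<union> add_ear p D \<Longrightarrow> a = p - 1"
    and "(p, a) \<in> sides (Suc n) \<union> add_ear p D \<Longrightarrow> a = Suc p"
  using assms by (auto simp: sides_def add_ear_def)

text \<open>The cyclic neighbours of \<open>p\<close> in \<open>S\<close> are joined to
  \<open>p\<close> by edges, so they are \<open>p - 1\<close> and \<open>Suc p\<close>. These two
  are joined by the new diagonal, which closes the region.\<close>

lemma region_at_ear:
  assumes "0 < p" "p < n" "n \<ge> 3" "D \<subseteq> diagonals n"
    and S: "S \<in> regions (Suc n) (add_ear p D)" and "p \<in> S"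
  shows "S = {p - 1, p, Suc p}"
proof -
  let ?E = "sides (Suc n) \<union> add_ear p D"
  have sub: "S \<subseteq> {..<Suc n}" and c: "card S \<ge> 3"
    and cc: "\<And>i j. i \<in> S \<Longrightarrow> j \<in> S \<Longrightarrow> i < j \<Longrightarrow> (i, j) \<in> ?E \<longleftrightarrow> cyclically_consecutive S i j"
    using S by (auto simp: regions_def)
  have fin: "finite S" using sub finite_subset by blast
  have big: "\<exists>k\<in>S. k \<noteq> x \<and> k \<noteq> y" for x y
  proof (rule ccontr)
    assume "\<not> ?thesis"
    then have "S \<subseteq> {x, y}" by auto
    then have "card S \<le> card {x, y}" by (intro card_mono) auto
    also have "\<dots> \<le> 2" by (simp add: card_insert_if)
    finally show False using c by simp
  qed
  have left: "p - 1 \<in> S"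
  proof (cases "\<exists>k\<in>S. k < p")
    case True
    let ?m = "Max {k\<in>S. k < p}"
    have "?m \<in> {k\<in>S. k < p}" using True fin by (intro Max_in) auto
    then have m: "?m \<in> S" "?m < p" by auto
    have "k \<le> ?m" if "k \<in> S" "k < p" for k using that fin by (intro Max_ge) auto
    then have "cyclically_consecutive S ?m p" unfolding cyclically_consecutive_def
      by (meson not_less)
    then have "?m = p - 1" using cc[OF m(1) \<open>p \<in> S\<close> m(2)] ear_edges(1)[OF assms(1,2,4)] by simp
    then show ?thesis using m by simp
  next
    case False
    \<comment> \<open>With nothing of \<open>S\<close> below \<open>p\<close>, the cyclic
      predecessor of \<open>p\<close> wraps around to \<open>Max S\<close>. The edge to it could
      only be \<open>(p, Suc p)\<close>, but some element of \<open>S\<close> lies beyond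
      \<open>Suc p\<close>.\<close>
    let ?m = "Max S"
    have m: "?m \<in> S" using fin \<open>p \<in> S\<close> by (intro Max_in) auto
    have ge: "k \<le> ?m" if "k \<in> S" for k using fin that by simp
    obtain k where k: "k \<in> S" "k \<noteq> p" "k \<noteq> Suc p" using big by blast
    have "Suc p < k" using False k by (metis Suc_lessI linorder_neqE_nat)
    then have l: "Suc p < ?m" using ge[OF k(1)] by simp
    have "cyclically_consecutive S p ?m" unfolding cyclically_consecutive_def
      using False ge by (meson not_less)
    then have "?m = Suc p" using cc[OF \<open>p \<in> S\<close> m] l ear_edges(2)[OF assms(1,2,4)] by simp
    then show ?thesis using l by simp
  qed
  have right: "Suc p \<in> S"
  proof (cases "\<exists>k\<in>S. p < k")
    case True
    let ?m = "Min {k\<in>S. p < k}"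
    have "?m \<in> {k\<in>S. p < k}" using True fin by (intro Min_in) auto
    then have m: "?m \<in> S" "p < ?m" by auto
    have "?m \<le> k" if "k \<in> S" "p < k" for k using that fin by (intro Min_le) auto
    then have "cyclically_consecutive S p ?m" unfolding cyclically_consecutive_def
      by (meson not_less)
    then have "?m = Suc p" using cc[OF \<open>p \<in> S\<close> m] ear_edges(2)[OF assms(1,2,4)] by simp
    then show ?thesis using m by simp
  next
    case False
    let ?m = "Min S"
    have m: "?m \<in> S" using fin \<open>p \<in> S\<close> by (intro Min_in) auto
    have le: "?m \<le> k" if "k \<in> S" for k using fin that by simp
    obtain k where k: "k \<in> S" "k \<noteq> p" "k \<noteq> p - 1" using big by blast
    have "k < p - 1" using False k by (metis Suc_pred' assms(1) less_antisym linorder_neqE_nat)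
    then have l: "?m < p - 1" using le[OF k(1)] by simp
    have "cyclically_consecutive S ?m p" unfolding cyclically_consecutive_def
      using False le by (meson not_less)
    then have "?m = p - 1" using cc[OF m \<open>p \<in> S\<close>] l ear_edges(1)[OF assms(1,2,4)] by simp
    then show ?thesis using l by simp
  qed
  have "(p - 1, Suc p) \<in> ?E" by (simp add: add_ear_def)
  then have "cyclically_consecutive S (p - 1) (Suc p)" using cc[OF left right] by simp
  \<comment> \<open>\<open>p\<close> itself lies strictly between the two, so it is the other arc
    that is empty.\<close>
  then have "\<forall>k\<in>S. \<not> (k < p - 1 \<or> Suc p < k)"
    using \<open>p \<in> S\<close> assms(1) unfolding cyclically_consecutive_def
    by (metis diff_less lessI less_numeral_extra(1))
  then have "k \<in> {p - 1, p, Suc p}" if "k \<in> S" for k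
    using that by (metis Suc_pred' assms(1) insert_iff less_antisym linorder_neqE_nat)
  then show ?thesis using left right \<open>p \<in> S\<close> by blast
qed

lemma ear_region:
  assumes "0 < p" "p < n" "n \<ge> 3" "D \<subseteq> diagonals n"
  shows "{p - 1, p, Suc p} \<in> regions (Suc n) (add_ear p D)"
proof -
  have "(p - 1, p) \<in> sides (Suc n)" "(p, Suc p) \<in> sides (Suc n)"
    "(p - 1, Suc p) \<in> add_ear p D"
    using assms by (auto simp: sides_def add_ear_def)
  moreover have "card {p - 1, p, Suc p} = 3" using assms(1) by (auto simp: card_insert_if)
  ultimately show ?thesis
    using assms by (auto simp: regions_def cyclically_consecutive_def)
qed

lemma regions_add_ear:
  assumes "0 < p" "p < n" "n \<ge> 3" "D \<subseteq> diagonals n"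
  shows "regions (Suc n) (add_ear p D) = insert {p - 1, p, Suc p} ((`) (skip p) ` regions n D)"
proof -
  have image: "skip p ` S \<in> regions (Suc n) (add_ear p D) \<longleftrightarrow> S \<in> regions n D" for S
  proof -
    have sub: "skip p ` S \<subseteq> {..<Suc n} \<longleftrightarrow> S \<subseteq> {..<n}"
      using skip_less_Suc_iff[OF assms(2)] by (auto simp del: lessThan_Suc)
    have card: "card (skip p ` S) = card S" by (intro card_image) (auto simp: inj_on_def)
    have *: "(skip p i, skip p j) \<in> sides (Suc n) \<union> add_ear p D \<longleftrightarrow> (i, j) \<in> sides n \<union> D"
      if "S \<subseteq> {..<n}" "i \<in> S" "j \<in> S" "i < j" for i j
      using add_ear_sides_iff[of p n i j D] assms that by auto
    show ?thesis
      unfolding regions_def mem_Collect_eq sub card ball_simps skip_less_iff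
        cyclically_consecutive_skip using * by blast
  qed
  show ?thesis
  proof (intro equalityI subsetI)
    fix S assume S: "S \<in> regions (Suc n) (add_ear p D)"
    show "S \<in> insert {p - 1, p, Suc p} ((`) (skip p) ` regions n D)"
    proof (cases "p \<in> S")
      case True
      have "S = {p - 1, p, Suc p}" by (rule region_at_ear[OF assms S True])
      then show ?thesis by (rule ssubst) (rule insertI1)
    next
      case False
      then have "\<exists>b. a = skip p b" if "a \<in> S" for a using that skip_surj by metis
      then have *: "skip p ` (skip p -` S) = S" by blast
      then have "skip p -` S \<in> regions n D" using S image[of "skip p -` S"] by simp
      then have "skip p ` (skip p -` S) \<in> (`) (skip p) ` regions n D" by (rule imageI)
      then show ?thesis unfolding * by (rule insertI2)
    qed
  next
    fix S assume "S \<in> insert {p - 1, p, Suc p} ((`) (skip p) ` regions n D)"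
    then show "S \<in> regions (Suc n) (add_ear p D)" using ear_region[OF assms] image by blast
  qed
qed

section \<open>Vertex labels after inserting an ear\<close>

lemma finite_regions: "finite (regions n D)"
  by (rule finite_subset[of _ "Pow {..<n}"]) (auto simp: regions_def)

lemma vertex_label_ear:
  assumes "0 < p" "p < n" "n \<ge> 3" "D \<subseteq> diagonals n"
  shows "vertex_label (Suc n) (add_ear p D) p = 1"
proof -
  have "{S \<in> regions (Suc n) (add_ear p D). p \<in> S} = {{p - 1, p, Suc p}}"
    unfolding regions_add_ear[OF assms] by auto
  then show ?thesis by (simp add: vertex_label_def)
qed

text \<open>\<open>skip p p\<close> is \<open>Suc p\<close>, so among the old vertices the new
  triangle touches exactly \<open>p - 1\<close> and \<open>p\<close>.\<close>

lemma vertex_label_skip: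
  assumes "0 < p" "p < n" "n \<ge> 3" "D \<subseteq> diagonals n"
  shows "vertex_label (Suc n) (add_ear p D) (skip p a) =
    (if a \<in> {p - 1, p} then Suc (vertex_label n D a) else vertex_label n D a)"
proof -
  let ?T = "{p - 1, p, Suc p}" and ?R = "{S \<in> regions n D. a \<in> S}"
  have T: "skip p a \<in> ?T \<longleftrightarrow> a \<in> {p - 1, p}"
    using assms by (auto simp: skip_def)
  have inj: "inj ((`) (skip p))" by (rule injI) (simp add: inj_image_eq_iff[OF inj_skip])
  have *: "{S \<in> insert T (F ` A). v \<in> S} =
      (if v \<in> T then insert T (F ` {S \<in> A. v \<in> F S}) else F ` {S \<in> A. v \<in> F S})"
    for T F A and v :: nat
    by auto
  have eq: "{S \<in> regions (Suc n) (add_ear p D). skip p a \<in> S} =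
     (if a \<in> {p - 1, p} then insert ?T ((`) (skip p) ` ?R) else (`) (skip p) ` ?R)"
    unfolding regions_add_ear[OF assms] T[symmetric]
    using inj_image_mem_iff[OF inj_skip] by (subst *) simp
  have "?T \<notin> (`) (skip p) ` ?R"
  proof -
    have "p \<notin> S" if "S \<in> (`) (skip p) ` ?R" for S using that by auto
    then show ?thesis by blast
  qed
  moreover have "card ((`) (skip p) ` ?R) = card ?R"
    using inj by (intro card_image inj_on_subset[OF inj]) simp
  ultimately show ?thesis
    using finite_regions unfolding vertex_label_def eq by simp
qed

lemma triangulated_add_ear_iff:
  assumes "0 < p" "p < n" "n \<ge> 3" "D \<subseteq> diagonals n"
  shows "triangulated_polygon (Suc n) (add_ear p D) \<longleftrightarrow> triangulated_polygon n D"
proof -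
  have "card {p - 1, p, Suc p} = 3" using assms(1) by (auto simp: card_insert_if)
  moreover have "card (skip p ` S) = card S" for S
    by (intro card_image) (auto simp: inj_on_def)
  ultimately show ?thesis
    using assms unfolding triangulated_polygon_def regions_add_ear[OF assms]
      noncrossing_add_ear_iff[OF assms] by auto
qed

section \<open>Existence of an ear\<close>

lemma triangulated_obtain_ear:
  assumes tri: "triangulated_polygon (Suc n) D" and "n \<ge> 3"
  obtains p D' where "0 < p" "p < n" "D' \<subseteq> diagonals n" "D = add_ear p D'"
proof -
  have sub: "D \<subseteq> diagonals (Suc n)" and nc: "\<And>d e. d \<in> D \<Longrightarrow> e \<in> D \<Longrightarrow> \<not> crossing d e"
    and card3: "\<And>S. S \<in> regions (Suc n) D \<Longrightarrow> card S = 3"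
    using tri by (auto simp: triangulated_polygon_def noncrossing_diagonals_def)
  \<comment> \<open>A shortest element of \<open>D\<close> cuts off a region without further diagonals. Adding the side \<open>(0, n)\<close>
    covers the case of an empty \<open>D\<close>, where this region is the whole polygon.\<close>
  define E where "E = insert (0, n) D"
  obtain e where e: "e \<in> E" and e_min: "\<And>e'. e' \<in> E \<Longrightarrow> snd e - fst e \<le> snd e' - fst e'"
    using arg_min_nat_lemma[of "\<lambda>e. e \<in> E" "(0, n)" "\<lambda>e. snd e - fst e"]
    unfolding E_def by blast
  obtain i j where [simp]: "e = (i, j)" by fastforce
  have ij: "(i, j) \<in> E" and min: "\<And>a b. (a, b) \<in> E \<Longrightarrow> j - i \<le> b - a"
    using e e_min by fastforce+
  have d: "i + 1 < j" "j < Suc n" using ij sub \<open>n \<ge> 3\<close> by (auto simp: diagonals_def E_def)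
  have "{i..j} \<in> regions (Suc n) D"
  proof -
    have "(a, b) \<in> sides (Suc n) \<union> D \<longleftrightarrow> cyclically_consecutive {i..j} a b"
      if ab: "i \<le> a" "a < b" "b \<le> j" for a b
    proof -
      have "(a, b) \<in> E \<longleftrightarrow> a = i \<and> b = j" using min[of a b] ij ab by auto
      moreover have "sides (Suc n) \<union> D = {(a, Suc a) | a. a < n} \<union> E"
        by (auto simp: sides_def E_def)
      moreover have "cyclically_consecutive {i..j} a b \<longleftrightarrow> b = Suc a \<or> a = i \<and> b = j"
      proof
        assume "cyclically_consecutive {i..j} a b"
        then consider "\<forall>k\<in>{i..j}. \<not> (a < k \<and> k < b)" | "\<forall>k\<in>{i..j}. \<not> (k < a \<or> b < k)"
          by (auto simp: cyclically_consecutive_def)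
        then show "b = Suc a \<or> a = i \<and> b = j"
        proof cases
          case 1 then show ?thesis using ab bspec[OF 1, of "Suc a"] by auto
        next
          case 2
          have "i \<in> {i..j}" "j \<in> {i..j}" using ab by auto
          then show ?thesis using ab bspec[OF 2, of i] bspec[OF 2, of j] by linarith
        qed
      qed (auto simp: cyclically_consecutive_def)
      ultimately show ?thesis using ab d by auto
    qed
    then show ?thesis using d by (auto simp: regions_def)
  qed
  \<comment> \<open>A region of a triangulation has three vertices, so \<open>Suc i\<close> is the
    tip of an ear. Lying strictly between \<open>i\<close> and \<open>j\<close>, it is neither
    \<open>0\<close> nor \<open>n\<close>.\<close>
  then have j: "j = i + 2" using card3 d by fastforce
  \<comment> \<open>\<open>j = i + 2\<close> and \<open>n \<ge> 3\<close> rule out the side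
    \<open>(0, n)\<close> that was added to \<open>D\<close>.\<close>
  then have ij: "(i, j) \<in> D" using ij \<open>n \<ge> 3\<close> by (auto simp: E_def)
  then have "(i, j) \<noteq> (0, n)" using sub by (auto simp: diagonals_def)
  define p where "p = Suc i"
  have p: "0 < p" "p < n" using j d by (auto simp: p_def)
  have pD: "(p - 1, Suc p) \<in> D" using ij j by (simp add: p_def)
  have not_p: "a \<noteq> p \<and> b \<noteq> p" if "(a, b) \<in> D" for a b
  proof -
    have "a + 1 < b" using that sub by (auto simp: diagonals_def)
    then show ?thesis using nc[OF that pD] p by auto
  qed
  define D' where "D' = {(a, b). (skip p a, skip p b) \<in> D - {(p - 1, Suc p)}}"
  have "D' \<subseteq> diagonals n"
  proof
    fix e assume "e \<in> D'"
    then obtain a b where e: "e = (a, b)" and "(skip p a, skip p b) \<in> D"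
      and ne: "(skip p a, skip p b) \<noteq> (p - 1, Suc p)"
      by (auto simp: D'_def)
    then have "skip p a + 1 < skip p b" "skip p b < Suc n" "(skip p a, skip p b) \<noteq> (0, n)"
      using sub by (auto simp: diagonals_def)
    then show "e \<in> diagonals n"
      using ne p unfolding e by (auto simp: diagonals_def skip_def split: if_splits)
  qed
  moreover have "D = add_ear p D'"
  proof (intro equalityI subsetI)
    fix e assume "e \<in> D"
    obtain a b where e: "e = (a, b)" by fastforce
    obtain a' b' where "a = skip p a'" "b = skip p b'"
      using not_p skip_surj \<open>e \<in> D\<close> e by metis
    then show "e \<in> add_ear p D'" using \<open>e \<in> D\<close> e by (force simp: add_ear_def D'_def)
  next
    fix e assume "e \<in> add_ear p D'"
    then show "e \<in> D" using pD by (auto simp: add_ear_def D'_def)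
  qed
  ultimately show ?thesis using that p by blast
qed

section \<open>Label lists and ear sequences\<close>

definition label_list :: "nat \<Rightarrow> (nat \<times> nat) set \<Rightarrow> nat list" where
  "label_list n D = map (vertex_label n D) [0..<n]"

lemma label_list_split:
  assumes "0 < p" "p < n"
  shows "label_list n D = map (vertex_label n D) [0..<p - 1] @ vertex_label n D (p - 1) #
    vertex_label n D p # map (vertex_label n D) [Suc p..<n]"
proof -
  have "[0..<n] = [0..<p - 1] @ (p - 1) # p # [Suc p..<n]"
    using assms upt_add_eq_append[of 0 "p - 1" "n - (p - 1)"] upt_conv_Cons[of "p - 1" n] upt_conv_Cons[of p n] by simp
  then show ?thesis by (simp add: label_list_def)
qed

text \<open>Compared with \<open>label_list_split\<close>, this is the rule \<open>ear\<close> for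
  the neighbours \<open>p - 1\<close> and \<open>p\<close>.\<close>

lemma label_list_add_ear:
  assumes "0 < p" "p < n" "n \<ge> 3" "D \<subseteq> diagonals n"
  shows "label_list (Suc n) (add_ear p D) = map (vertex_label n D) [0..<p - 1] @
    Suc (vertex_label n D (p - 1)) # 1 # Suc (vertex_label n D p) # map (vertex_label n D) [Suc p..<n]"
proof -
  let ?L = "vertex_label (Suc n) (add_ear p D)"
  have "[0..<Suc n] = [0..<p] @ p # [Suc p..<Suc n]"
    using assms upt_add_eq_append[of 0 p "Suc n - p"] upt_conv_Cons[of p "Suc n"]
    by (simp del: upt_Suc)
  also have "[0..<p] = map (skip p) [0..<p]" by (rule map_idI[symmetric]) (simp add: skip_def)
  also have "[Suc p..<Suc n] = map (skip p) [p..<n]"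
    unfolding map_Suc_upt[symmetric] by (rule map_cong) (auto simp: skip_def)
  also have "[0..<p] = [0..<p - 1] @ [p - 1]"
    using assms(1) by (metis Suc_pred' le0 upt_Suc_append)
  also have "[p..<n] = p # [Suc p..<n]" using assms(2) by (rule upt_conv_Cons)
  finally have "[0..<Suc n] = map (skip p) [0..<p - 1] @ [skip p (p - 1)] @ p # skip p p # map (skip p) [Suc p..<n]"
    by simp
  moreover have "map ?L (map (skip p) [0..<p - 1]) = map (vertex_label n D) [0..<p - 1]"
    "map ?L (map (skip p) [Suc p..<n]) = map (vertex_label n D) [Suc p..<n]"
    using assms(1) by (auto simp: vertex_label_skip[OF assms])
  ultimately show ?thesis
    unfolding label_list_def by (simp add: vertex_label_ear[OF assms] vertex_label_skip[OF assms] del: upt_Suc)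
qed

lemma regions_triangle: "regions 3 {} = {{0, 1, 2}}"
proof -
  have 3: "{..<3} = {0, 1, 2::nat}" by auto
  have "S = {0, 1, 2}" if "S \<in> regions 3 {}" for S
  proof (rule card_seteq)
    show "S \<subseteq> {0, 1, 2}" "card {0, 1, 2::nat} \<le> card S"
      using that 3 by (simp_all add: regions_def)
  qed simp
  moreover have "{0, 1, 2} \<in> regions 3 {}"
    unfolding regions_def mem_Collect_eq 3
    by (simp add: sides_def cyclically_consecutive_def)
  ultimately show ?thesis by blast
qed

lemma triangulated_triangle_iff: "triangulated_polygon 3 D \<longleftrightarrow> D = {}"
proof -
  have "diagonals 3 = {}" by (auto simp: diagonals_def)
  then show ?thesis
    by (auto simp: triangulated_polygon_def noncrossing_diagonals_def regions_triangle)
qed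

lemma label_list_triangle: "label_list 3 {} = [1, 1, 1]"
proof -
  have "vertex_label 3 {} v = 1" if "v \<in> {0, 1, 2}" for v
  proof -
    have "{S \<in> regions 3 {}. v \<in> S} = {{0, 1, 2}}" using that by (auto simp: regions_triangle)
    then show ?thesis by (simp add: vertex_label_def)
  qed
  moreover have "[0..<3] = [0, 1, 2]" by (simp add: upt_rec)
  ultimately show ?thesis by (simp add: label_list_def)
qed

lemma ear_sequence_label_list:
  assumes "triangulated_polygon n D"
  shows "ear_sequence (label_list n D)"
proof -
  have "n \<ge> 3" using assms by (simp add: triangulated_polygon_def)
  then show ?thesis using assms
  proof (induction n arbitrary: D rule: dec_induct)
    case base
    then show ?case using label_list_triangle triangulated_triangle_iff ear_sequence.triangle by metis
  next
    case (step n)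
    obtain p D' where p: "0 < p" "p < n" "D' \<subseteq> diagonals n" "D = add_ear p D'"
      using triangulated_obtain_ear step by metis
    then have "triangulated_polygon n D'" using triangulated_add_ear_iff step by metis
    then show ?case
      using step.IH[of D'] p step.hyps label_list_add_ear[of p n D'] label_list_split[of p n D']
      by (simp add: ear_sequence.ear del: One_nat_def)
  qed
qed

lemma ear_sequence_realized:
  assumes "ear_sequence q"
  shows "\<exists>n D. triangulated_polygon n D \<and> q = label_list n D"
  using assms
proof induction
  case triangle
  then show ?case using label_list_triangle triangulated_triangle_iff by metis
next
  case (ear xs a b ys)
  then obtain n D where nD: "triangulated_polygon n D" "xs @ a # b # ys = label_list n D" by blast
  \<comment> \<open>The new vertex goes between the positions of \<open>a\<close> and
    \<open>b\<close>, which are \<open>length xs\<close> and \<open>Suc (length xs)\<close>.\<close>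
  let ?p = "Suc (length xs)"
  have "length (label_list n D) = n" by (simp add: label_list_def)
  then have p: "0 < ?p" "?p < n" unfolding nD(2)[symmetric] by auto
  have D: "n \<ge> 3" "D \<subseteq> diagonals n"
    using nD by (auto simp: triangulated_polygon_def noncrossing_diagonals_def)
  have "xs @ a # b # ys = map (vertex_label n D) [0..<?p - 1] @ vertex_label n D (?p - 1) #
    vertex_label n D ?p # map (vertex_label n D) [Suc ?p..<n]"
    unfolding nD(2) by (rule label_list_split[OF p])
  then have "xs @ Suc a # 1 # Suc b # ys = label_list (Suc n) (add_ear ?p D)"
    unfolding label_list_add_ear[OF p D] by (subst (asm) append_eq_append_conv) auto
  then show ?case using triangulated_add_ear_iff[OF p D] nD(1) by blast
qed

section \<open>Closure of ear sequences under rotation and reversal\<close>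

text \<open>The rule \<open>ear\<close> never inserts between the last and the first entry; this
  fills the gap. The outer ear is added to the smaller sequence first and the inner ear afterwards.
  The cases differ in whether the inner ear has the first or the last entry as a neighbour.\<close>

lemma ear_sequence_outer_ear:
  "ear_sequence (a # m @ [b]) \<Longrightarrow> ear_sequence (1 # Suc a # m @ [Suc b])"
proof (induction "a # m @ [b]" arbitrary: a m b rule: ear_sequence.induct)
  case triangle
  then have "m = [1] \<and> b = 1" by (cases m) (auto simp: Cons_eq_append_conv)
  moreover have "ear_sequence ([1] @ Suc 1 # 1 # Suc 1 # [])"
    using ear_sequence.ear[of "[1]" 1 1 "[]"] ear_sequence.triangle by simp
  ultimately show ?case by simp
next
  case (ear xs c d ys)
  show ?case
  proof (cases xs; cases ys rule: rev_cases)
    assume "xs = []" "ys = []"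
    then show ?case
      using ear.hyps(2)[of c "[]" d] ear.hyps(3)[symmetric] ear_sequence.ear[of "[1]" "Suc c" "Suc d" "[]"] by simp
  next
    fix ys' b' assume "xs = []" "ys = ys' @ [b']"
    then show ?case
      using ear.hyps(2)[of c "d # ys'" b] ear.hyps(3)[symmetric]
        ear_sequence.ear[of "[1]" "Suc c" "d" "ys' @ [Suc b]"] by auto
  next
    fix a' xs' assume "xs = a' # xs'" "ys = []"
    then show ?case
      using ear.hyps(2)[of a "xs' @ [c]" d] ear.hyps(3)[symmetric]
        ear_sequence.ear[of "1 # Suc a # xs'" c "Suc d" "[]"] by auto
  next
    fix a' xs' ys' b' assume "xs = a' # xs'" "ys = ys' @ [b']"
    then show ?case
      using ear.hyps(2)[of a "xs' @ c # d # ys'" b] ear.hyps(3)[symmetric]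
        ear_sequence.ear[of "1 # Suc a # xs'" c d "ys' @ [Suc b]"] by auto
  qed
qed

text \<open>If \<open>xs\<close> is empty, then rotation moves \<open>Suc a\<close> to the end, and
  the ear now sits between the last and the first entry of the smaller sequence.\<close>

lemma ear_sequence_rotate1: "ear_sequence q \<Longrightarrow> ear_sequence (rotate1 q)"
proof (induction rule: ear_sequence.induct)
  case triangle
  then show ?case using ear_sequence.triangle by simp
next
  case (ear xs a b ys)
  show ?case
  proof (cases xs)
    case Nil
    then show ?thesis using ear.IH ear_sequence_outer_ear[of b ys a] by simp
  next
    case (Cons c xs')
    then show ?thesis using ear.IH ear_sequence.ear[of xs' a b "ys @ [c]"] by simp
  qed
qed

lemma ear_sequence_rotate: "ear_sequence q \<Longrightarrow> ear_sequence (rotate s q)"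
  by (induction s) (simp_all add: ear_sequence_rotate1)

lemma ear_sequence_swap: "ear_sequence (xs @ ys) \<Longrightarrow> ear_sequence (ys @ xs)"
  using ear_sequence_rotate[of "xs @ ys" "length xs"] by (simp add: rotate_append)

lemma ear_sequence_rev: "ear_sequence q \<Longrightarrow> ear_sequence (rev q)"
proof (induction rule: ear_sequence.induct)
  case triangle
  then show ?case using ear_sequence.triangle by simp
next
  case (ear xs a b ys)
  then show ?case using ear_sequence.ear[of "rev ys" b a "rev xs"] by simp
qed

lemma ear_sequence_length: "ear_sequence q \<Longrightarrow> length q \<ge> 3"
  by (induction rule: ear_sequence.induct) auto

lemma ear_sequence_pos: "ear_sequence q \<Longrightarrow> a \<in> set q \<Longrightarrow> 0 < a"
  by (induction rule: ear_sequence.induct) auto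

lemma quiddity_sequence_iff_ear_sequence: "quiddity_sequence q \<longleftrightarrow> ear_sequence q"
proof
  assume "quiddity_sequence q"
  then show "ear_sequence q"
    using ear_sequence_label_list ear_sequence_rotate
    unfolding quiddity_sequence_def label_list_def by blast
next
  assume "ear_sequence q"
  then obtain n D where "triangulated_polygon n D" "q = rotate 0 (label_list n D)"
    using ear_sequence_realized by fastforce
  then show "quiddity_sequence q" unfolding quiddity_sequence_def label_list_def by blast
qed

lemma trimmed_quiddity_sequence_iff:
  "trimmed_quiddity_sequence t \<longleftrightarrow> (\<exists>c. ear_sequence (t @ [c]))"
proof
  assume "trimmed_quiddity_sequence t"
  then obtain q where q: "ear_sequence q" "t = butlast q"
    by (auto simp: trimmed_quiddity_sequence_def quiddity_sequence_iff_ear_sequence)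
  moreover have "q \<noteq> []" using ear_sequence_length[OF q(1)] by auto
  ultimately have "q = t @ [last q]" by simp
  then show "\<exists>c. ear_sequence (t @ [c])" using q by metis
next
  assume "\<exists>c. ear_sequence (t @ [c])"
  then obtain c where "ear_sequence (t @ [c])" ..
  then show "trimmed_quiddity_sequence t"
    unfolding trimmed_quiddity_sequence_def quiddity_sequence_iff_ear_sequence
    by (intro exI[of _ "t @ [c]"]) simp
qed

lemma trimmed_quiddity_sequence_rev:
  assumes "trimmed_quiddity_sequence t"
  shows "trimmed_quiddity_sequence (rev t)"
proof -
  obtain c where "ear_sequence (t @ [c])" using assms trimmed_quiddity_sequence_iff by blast
  then have "ear_sequence ([c] @ rev t)" using ear_sequence_rev by fastforce
  then show ?thesis using ear_sequence_swap trimmed_quiddity_sequence_iff by blast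
qed

section \<open>Sufficient condition for unavoidability\<close>

text \<open>The pair \<open>(p, q)\<close> stands for the value \<open>p/q\<close> of the continued fraction; the start \<open>(1, 0)\<close> is infinity.\<close>

fun positive_run :: "int \<Rightarrow> int \<Rightarrow> nat list \<Rightarrow> bool" where
  "positive_run p q [] \<longleftrightarrow> True"
| "positive_run p q (c # cs) \<longleftrightarrow> 0 < int c * p - q \<and> positive_run (int c * p - q) p cs"

text \<open>The entries \<open>Suc a, 1, Suc b\<close> and the entries \<open>a, b\<close> lead from
  \<open>(p, q)\<close> to the same pair, and the numerators met on the shorter way also occur on
  the longer one.\<close>

lemma positive_run_remove_ear:
  "positive_run p q (xs @ Suc a # 1 # Suc b # ys) \<Longrightarrow> positive_run p q (xs @ a # b # ys)"
  by (induction xs arbitrary: p q) (auto simp: algebra_simps)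

text \<open>This is the case in which the trimmed entry is the right neighbour of the ear.\<close>

lemma positive_run_remove_last_ear:
  "positive_run p q (xs @ [Suc a, 1]) \<Longrightarrow> positive_run p q (xs @ [a])"
  by (induction xs arbitrary: p q) (auto simp: algebra_simps)

text \<open>The run along \<open>[1, 1]\<close> has the numerators 1 and 0, and removing an ear
  preserves positivity.\<close>

lemma ear_sequence_not_positive_run: "ear_sequence q \<Longrightarrow> \<not> positive_run 1 0 (butlast q)"
proof (induction rule: ear_sequence.induct)
  case (ear xs a b ys)
  show ?case
  proof (cases ys rule: rev_cases)
    case Nil
    then show ?thesis
      using ear.IH positive_run_remove_last_ear[of 1 0 xs a] by (auto simp: butlast_append)
  next
    case (snoc ys' c)
    then show ?thesis
      using ear.IH positive_run_remove_ear[of 1 0 xs a b ys'] by (auto simp: butlast_append)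
  qed
qed simp

text \<open>The invariant is that the current value \<open>p/q\<close> exceeds \<open>l c\<close>
  for the last letter \<open>c\<close>. The next value is then \<open>d - q/p > d - 1 / l c\<close>,
  which is at least \<open>l d\<close>.\<close>

lemma positive_run_step:
  fixes l :: "nat \<Rightarrow> real"
  assumes l: "\<And>c. 0 < c \<Longrightarrow> 0 < l c"
    and step: "\<And>c d. 0 < c \<Longrightarrow> 0 < d \<Longrightarrow> R c d \<Longrightarrow> 1 / l c + l d \<le> d"
  shows "successively R (c # t) \<Longrightarrow> \<forall>a\<in>set (c # t). 0 < a \<Longrightarrow> 0 < q \<Longrightarrow>
    l c * of_int q < of_int p \<Longrightarrow> positive_run p q t"
proof (induction t arbitrary: c p q)
  case (Cons d t)
  have pos: "0 < c" "0 < d" "0 < l c" "0 < l d" using Cons.prems l by auto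
  have "0 < l c * of_int q" using pos(3) \<open>0 < q\<close> by simp
  then have p: "0 < real_of_int p" using Cons.prems(4) by linarith
  have "of_int q < of_int p / l c"
    using Cons.prems(4) pos(3) by (simp add: field_simps)
  moreover have "(1 / l c + l d) * of_int p \<le> real d * of_int p"
    using p step[of c d] pos Cons.prems(1) by (intro mult_right_mono) auto
  ultimately have *: "l d * of_int p < of_int (int d * p - q)"
    by (simp add: distrib_right)
  moreover have "0 < l d * of_int p" using pos p by simp
  ultimately have "0 < int d * p - q" by linarith
  moreover have "positive_run (int d * p - q) p t"
    using Cons.IH[of d p "int d * p - q"] Cons.prems(1,2) p * by auto
  ultimately show ?case by simp
qed simp

lemma sublist_same_length_eq: "sublist x y \<Longrightarrow> length x = length y \<Longrightarrow> x = y"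
  by (auto simp: sublist_def)

lemma avoiding_successively:
  "\<forall>x\<in>X. \<not> sublist x t \<Longrightarrow> successively (\<lambda>c d. [c, d] \<notin> X) t"
proof (induction "\<lambda>c d. [c, d] \<notin> X" t rule: successively.induct)
  case (3 c d t)
  have "sublist [c, d] (c # d # t)" by (metis append_Cons append_Nil sublist_append_rightI)
  then have "[c, d] \<notin> X" using 3 by blast
  then show ?case using 3 sublist_Cons_right by (metis successively.simps(3))
qed auto

text \<open>The first letter \<open>c\<close> takes the value from infinity to \<open>c\<close>, so
  \<open>l c < c\<close> starts the invariant of \<open>positive_run_step\<close>.\<close>

lemma trimmed_hits_bound:
  fixes l :: "nat \<Rightarrow> real"
  assumes l: "\<And>c. 0 < c \<Longrightarrow> 0 < l c \<and> l c < c"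
    and step: "\<And>c d. 0 < c \<Longrightarrow> 0 < d \<Longrightarrow> [c, d] \<notin> X \<Longrightarrow> 1 / l c + l d \<le> d"
    and t: "trimmed_quiddity_sequence t"
  shows "\<exists>x\<in>X. sublist x t"
proof (rule ccontr)
  assume "\<not> ?thesis"
  then have succ: "successively (\<lambda>c d. [c, d] \<notin> X) t" by (intro avoiding_successively) auto
  obtain e where e: "ear_sequence (t @ [e])" using t trimmed_quiddity_sequence_iff by blast
  have pos: "\<forall>a\<in>set t. 0 < a" using ear_sequence_pos[OF e] by simp
  have "positive_run 1 0 t"
  proof (cases t)
    case (Cons c t')
    then have "positive_run c 1 t'"
      using succ pos l positive_run_step[where l = l and R = "\<lambda>c d. [c, d] \<notin> X" and c = c] step by simp
    then show ?thesis using Cons pos by simp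
  qed simp
  then show False using ear_sequence_not_positive_run[OF e] by simp
qed

lemma unavoidable_pairs:
  fixes l :: "nat \<Rightarrow> real"
  assumes "finite X" and X: "\<forall>x\<in>X. length x = 2 \<and> (\<forall>a\<in>set x. 0 < a)"
    and "\<And>c. 0 < c \<Longrightarrow> 0 < l c \<and> l c < c"
    and "\<And>c d. 0 < c \<Longrightarrow> 0 < d \<Longrightarrow> [c, d] \<notin> X \<Longrightarrow> 1 / l c + l d \<le> d"
  shows "unavoidable_set X"
proof -
  have "without_redundancy X"
    using X sublist_same_length_eq unfolding without_redundancy_def by metis
  then show ?thesis
    using assms trimmed_hits_bound[of l X] unfolding unavoidable_set_def by fastforce
qed

text \<open>All letters above 5 behave alike, since none occurs in \<open>X\<close>; the letter 6
  represents them. This makes the hypotheses a finite check.\<close>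

lemma unavoidable_pairs_table:
  fixes ls :: "real list"
  assumes "finite X" and X: "\<forall>x\<in>X. length x = 2 \<and> set x \<subseteq> {1..5}"
    and l: "\<forall>c\<in>{1, 2, 3, 4, 5, 6}. 0 < ls ! (c - 1) \<and> ls ! (c - 1) < c"
    and step: "\<forall>c\<in>{1, 2, 3, 4, 5, 6}. \<forall>d\<in>{1, 2, 3, 4, 5, 6}.
      [c, d] \<notin> X \<longrightarrow> 1 / ls ! (c - 1) + ls ! (d - 1) \<le> d"
  shows "unavoidable_set X"
proof (rule unavoidable_pairs[where l = "\<lambda>c. ls ! (min c 6 - 1)"])
  have range: "min c 6 \<in> {1, 2, 3, 4, 5, 6}" if "0 < c" for c :: nat
  proof -
    have "n \<in> {1, 2, 3, 4, 5, 6}" if "0 < n" "n \<le> 6" for n :: nat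
      using that by (simp add: eval_nat_numeral le_Suc_eq)
    then show ?thesis using that by simp
  qed
  fix c d :: nat
  assume "0 < c"
  have min_le: "real (min n 6) \<le> real n" for n by simp
  from min_le[of c] show "0 < ls ! (min c 6 - 1) \<and> ls ! (min c 6 - 1) < c"
    using bspec[OF l range[OF \<open>0 < c\<close>]] by linarith
  assume "0 < d" "[c, d] \<notin> X"
  \<comment> \<open>Truncation changes only letters above 6, and a pair containing 6 is never in
    \<open>X\<close>.\<close>
  moreover have "[min c 6, min d 6] \<notin> X" if "[c, d] \<notin> X"
    using that X by (cases "c \<le> 6"; cases "d \<le> 6") (fastforce simp: min_def)+
  ultimately have "1 / ls ! (min c 6 - 1) + ls ! (min d 6 - 1) \<le> real (min d 6)"
    using bspec[OF bspec[OF step range[OF \<open>0 < c\<close>]] range[OF \<open>0 < d\<close>]] by blast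
  with min_le[of d] show "1 / ls ! (min c 6 - 1) + ls ! (min d 6 - 1) \<le> d" by linarith
qed (use assms(1) X in \<open>auto simp: subset_iff Suc_le_eq\<close>)

text \<open>
  The entries of the tables come from periodic words avoiding \<open>O\<^sub>k\<close> on which the continued fraction has a
  single (parabolic) fixed point, such as \<open>2, 1, 5, 2, 1, 5, \<dots>\<close> for \<open>O2\<close> and
  \<open>5, 2, 1, 3, 5, 2, 1, 3, \<dots>\<close> for \<open>O4\<close>.
\<close>

lemma unavoidable_O1: "unavoidable_set O1"
  by (rule unavoidable_pairs_table[of _ "[1 / 2, 1, 2, 2, 2, 2]"]) (simp_all add: O1_def)

lemma unavoidable_O2: "unavoidable_set O2"
  by (rule unavoidable_pairs_table[of _ "[1 / 3, 3 / 2, 2, 2, 2, 2]"]) (simp_all add: O2_def)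

lemma unavoidable_O3: "unavoidable_set O3"
  by (rule unavoidable_pairs_table[of _ "[1 / 3, 3 / 2, 2, 1, 2, 2]"]) (simp_all add: O3_def)

lemma unavoidable_O4: "unavoidable_set O4"
  by (rule unavoidable_pairs_table[of _ "[2 / 5, 5 / 3, 1 / 2, 3 / 2, 3, 3]"]) (simp_all add: O4_def)

lemma unavoidable_O5: "unavoidable_set O5"
  by (rule unavoidable_pairs_table[of _ "[2 / 5, 5 / 3, 1 / 2, 3 / 2, 5 / 2, 3]"]) (simp_all add: O5_def)

lemma unavoidable_O6: "unavoidable_set O6"
  by (rule unavoidable_pairs_table[of _ "[2 / 5, 5 / 3, 1 / 2, 2, 3, 3]"]) (simp_all add: O6_def)

lemma unavoidable_O7: "unavoidable_set O7"
  by (rule unavoidable_pairs_table[of _ "[2 / 5, 5 / 3, 1 / 2, 2, 5 / 2, 3]"]) (simp_all add: O7_def)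

lemma unavoidable_O8: "unavoidable_set O8"
  by (rule unavoidable_pairs_table[of _ "[2 / 5, 5 / 3, 1 / 2, 3, 3, 3]"]) (simp_all add: O8_def)

lemma unavoidable_O9: "unavoidable_set O9"
  by (rule unavoidable_pairs_table[of _ "[2 / 5, 5 / 3, 1 / 2, 3, 5 / 2, 3]"]) (simp_all add: O9_def)

lemma sublist_reversal:
  "(\<exists>x\<in>reversal X. sublist x t) \<longleftrightarrow> (\<exists>x\<in>X. sublist x (rev t))"
  by (simp add: reversal_def sublist_rev_left)

lemma unavoidable_set_reversal:
  assumes "unavoidable_set X"
  shows "unavoidable_set (reversal X)"
  using assms trimmed_quiddity_sequence_rev
  unfolding unavoidable_set_def without_redundancy_def sublist_reversal
  by (auto simp: reversal_def)

lemma reversal_le_iff: "reversal X \<preceq> Y \<longleftrightarrow> X \<preceq> reversal Y"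
  by (simp add: unavoidable_le_def reversal_def sublist_rev_left)

section \<open>Test sequences\<close>

text \<open>Using \<open>sublist\<close> instead of membership accounts for words of length one,
  which may occur in a set of length two.\<close>

definition hits :: "nat list set \<Rightarrow> nat \<Rightarrow> nat \<Rightarrow> bool" where
  "hits X c d \<longleftrightarrow> (\<exists>x\<in>X. sublist x [c, d])"

text \<open>\<open>length t \<ge> 2\<close> ensures that even a single letter of \<open>t\<close>
  belongs to a pair of neighbours.\<close>

lemma short_sublist_pair:
  "sublist x t \<Longrightarrow> length x \<le> 2 \<Longrightarrow> length t \<ge> 2 \<Longrightarrow> \<not> successively (\<lambda>c d. \<not> sublist x [c, d]) t"
proof (induction "\<lambda>c d. \<not> sublist x [c, d]" t rule: successively.induct)
  case (3 c d t)
  show ?case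
  proof
    assume "successively (\<lambda>c d. \<not> sublist x [c, d]) (c # d # t)"
    then have *: "\<not> sublist x [c, d]" "successively (\<lambda>c d. \<not> sublist x [c, d]) (d # t)" by simp_all
    have "prefix x [c, d]" if "prefix x (c # d # t)"
      using that 3(3) by (cases x; cases "tl x") auto
    then have "sublist x (d # t)"
      using 3(2) * by (auto simp: sublist_Cons_right)
    moreover have "sublist x [c, d]" if "sublist x [d]"
      using that by (simp add: sublist_Cons_right)
    ultimately show False using * 3(1,3) by (cases t) auto
  qed
qed auto

text \<open>This is how test sequences are used: if certain pairs are not hit, then a trimmed
  sequence whose neighbours form only such pairs is a contradiction.\<close>

lemma unavoidable_hits:
  assumes X: "unavoidable_set X" "\<forall>x\<in>X. length x \<le> 2" and e: "ear_sequence (t @ [c])"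
  shows "\<not> successively (\<lambda>c d. \<not> hits X c d) t"
proof
  assume s: "successively (\<lambda>c d. \<not> hits X c d) t"
  obtain x where x: "x \<in> X" "sublist x t"
    using X(1) e by (auto simp: unavoidable_set_def trimmed_quiddity_sequence_iff)
  have "successively (\<lambda>c d. \<not> sublist x [c, d]) t"
    by (rule successively_mono[OF s]) (use x in \<open>auto simp: hits_def\<close>)
  then show False
    using short_sublist_pair[OF x(2)] X(2) x(1) ear_sequence_length[OF e] by auto
qed

text \<open>
  A letter exceeding all letters of \<open>X\<close> cannot help to hit a pair, so the other letter is itself
  a word of \<open>X\<close>.
\<close>

lemma hits_large:
  assumes "unavoidable_set X"
  obtains K where "\<And>a b c. hits X a (Suc K) \<Longrightarrow> hits X b a \<and> hits X a c"
    and "\<And>a b c. hits X (Suc K) a \<Longrightarrow> hits X b a \<and> hits X a c"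
proof -
  have "finite (\<Union>x\<in>X. set x)" and ne: "[] \<notin> X"
    using assms by (auto simp: unavoidable_set_def)
  then obtain K where K: "\<forall>a\<in>(\<Union>x\<in>X. set x). a \<le> K"
    using finite_nat_set_iff_bounded_le by blast
  have single: "[a] \<in> X" if "x \<in> X" "sublist x [a, Suc K] \<or> sublist x [Suc K, a]" for x a
  proof -
    have "Suc K \<notin> set x" using K that(1) by fastforce
    moreover have "x \<noteq> []" using ne that(1) by auto
    ultimately have "x = [a]"
      using that(2) by (auto simp: sublist_Cons_right prefix_Cons)
    then show ?thesis using that(1) by simp
  qed
  have pair: "hits X b a \<and> hits X a c" if "[a] \<in> X" for a b c
    using that by (auto simp: hits_def sublist_Cons_right intro!: bexI[of _ "[a]"])
  show ?thesis
    by (rule that[of K]) (use single pair in \<open>unfold hits_def, blast\<close>)+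
qed

section \<open>Explicit ear sequences\<close>

lemma ear_sequence_ear_at:
  assumes "ear_sequence q" "Suc k < length q"
  shows "ear_sequence (take k q @ Suc (q ! k) # 1 # Suc (q ! Suc k) # drop (Suc (Suc k)) q)"
proof -
  have "q = take k q @ q ! k # q ! Suc k # drop (Suc (Suc k)) q"
    using assms(2) by (metis Cons_nth_drop_Suc Suc_lessD id_take_nth_drop)
  then show ?thesis using assms(1) ear_sequence.ear by metis
qed

text \<open>The periodic ones are useful because few different pairs occur in them: repeating
  \<open>2, 1, 4\<close>, for instance, yields only \<open>(2, 1)\<close>, \<open>(1, 4)\<close> and
  \<open>(4, 2)\<close>.\<close>

lemma ear_sequences_small:
  "ear_sequence [1, 1, 1]"
  "ear_sequence [1, 2, 1, 2]"
  "ear_sequence [2, 1, 2, 1]"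
  "ear_sequence [1, 3, 1, 3, 1, 3]"
  "ear_sequence [2, 1, 3, 2, 1, 3]"
  "ear_sequence [2, 1, 4, 2, 1, 4, 2, 1, 4]"
  "ear_sequence [2, 1, 3, 4, 2, 1, 3, 4, 2, 1, 3, 4]"
proof -
  note ear_at = ear_sequence_ear_at
  show 0: "ear_sequence [1, 1, 1]" by (rule ear_sequence.triangle)
  show 1: "ear_sequence [1, 2, 1, 2]" using ear_at[OF 0, of 1] by (simp add: eval_nat_numeral)
  show 2: "ear_sequence [2, 1, 2, 1]" using ear_at[OF 0, of 0] by (simp add: eval_nat_numeral)
  have "ear_sequence [1, 3, 1, 2, 2]" using ear_at[OF 1, of 1] by (simp add: eval_nat_numeral)
  from ear_at[OF this, of 3] show "ear_sequence [1, 3, 1, 3, 1, 3]" by (simp add: eval_nat_numeral)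
  have 3: "ear_sequence [2, 1, 3, 1, 2]" using ear_at[OF 2, of 2] by (simp add: eval_nat_numeral)
  from ear_at[OF this, of 3] show 4: "ear_sequence [2, 1, 3, 2, 1, 3]" by (simp add: eval_nat_numeral)
  from ear_at[OF 3, of 2] have "ear_sequence [2, 1, 4, 1, 2, 2]" by (simp add: eval_nat_numeral)
  from ear_at[OF this, of 3] have "ear_sequence [2, 1, 4, 2, 1, 3, 2]" by (simp add: eval_nat_numeral)
  from ear_at[OF this, of 5] have "ear_sequence [2, 1, 4, 2, 1, 4, 1, 3]" by (simp add: eval_nat_numeral)
  from ear_at[OF this, of 6] show "ear_sequence [2, 1, 4, 2, 1, 4, 2, 1, 4]" by (simp add: eval_nat_numeral)
  from ear_at[OF 4, of 3] have "ear_sequence [2, 1, 3, 3, 1, 2, 3]" by (simp add: eval_nat_numeral)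
  from ear_at[OF this, of 3] have "ear_sequence [2, 1, 3, 4, 1, 2, 2, 3]" by (simp add: eval_nat_numeral)
  from ear_at[OF this, of 4] have "ear_sequence [2, 1, 3, 4, 2, 1, 3, 2, 3]" by (simp add: eval_nat_numeral)
  from ear_at[OF this, of 7] have "ear_sequence [2, 1, 3, 4, 2, 1, 3, 3, 1, 4]" by (simp add: eval_nat_numeral)
  from ear_at[OF this, of 7] have "ear_sequence [2, 1, 3, 4, 2, 1, 3, 4, 1, 2, 4]" by (simp add: eval_nat_numeral)
  from ear_at[OF this, of 8] show "ear_sequence [2, 1, 3, 4, 2, 1, 3, 4, 2, 1, 3, 4]"
    by (simp add: eval_nat_numeral)
qed

lemma concat_replicate_Suc_right: "concat (replicate (Suc m) u) = concat (replicate m u) @ u"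
  by (induction m) auto

text \<open>This is the fan, with all diagonals at one vertex; its label \<open>Suc m\<close> can be
  made as large as desired.\<close>

lemma ear_sequence_fan: "ear_sequence (replicate m 2 @ [1, Suc m, 1])"
proof (induction m)
  case 0
  then show ?case using ear_sequence.triangle by simp
next
  case (Suc m)
  from ear_sequence.ear[OF this] show ?case by (simp add: replicate_append_same[symmetric] numeral_2_eq_2)
qed

text \<open>Each inductive step inserts two ears to the left of the large entry. The final rotation
  makes the last \<open>2\<close> the trimmed entry, which removes the pair
  \<open>(1, 2)\<close>.\<close>

lemma ear_sequence_4_1: "ear_sequence ([Suc m, 2, 1] @ concat (replicate m [4, 1]) @ [2])"
proof -
  have "ear_sequence (concat (replicate m [4, 1]) @ [2, Suc m, 2, 1])"
  proof (induction m)
    case 0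
    then show ?case using ear_sequences_small(3) by simp
  next
    case (Suc m)
    let ?u = "concat (replicate m [4, 1])"
    have "ear_sequence (?u @ [3, 1, Suc (Suc m), 2, 1])"
      using ear_sequence.ear[OF Suc] by (simp add: numeral_3_eq_3 numeral_2_eq_2)
    then have "ear_sequence (?u @ [Suc 3, 1, Suc 1, Suc (Suc m), 2, 1])" by (rule ear_sequence.ear)
    then show ?case unfolding concat_replicate_Suc_right by (simp add: eval_nat_numeral)
  qed
  then show ?thesis using ear_sequence_swap[of "concat (replicate m [4, 1]) @ [2]" "[Suc m, 2, 1]"] by simp
qed

text \<open>Each inductive step inserts three ears, turning \<open>3, Suc m\<close> into
  \<open>5, 2, 1, 3, Suc (Suc m)\<close>.\<close>

lemma ear_sequence_2_1_5: "ear_sequence (concat (replicate m [2, 1, 5]) @ [2, 1, 3, Suc m, 2])"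
proof (induction m)
  case 0
  then show ?case
    using ear_sequence_ear_at[OF ear_sequences_small(3), of 2] by (simp add: eval_nat_numeral)
next
  case (Suc m)
  let ?u = "concat (replicate m [2, 1, 5])"
  have "ear_sequence ((?u @ [2, 1]) @ 3 # Suc m # [2])" using Suc by simp
  then have "ear_sequence ((?u @ [2, 1]) @ Suc 3 # 1 # Suc (Suc m) # [2])" by (rule ear_sequence.ear)
  then have "ear_sequence ((?u @ [2, 1]) @ Suc (Suc 3) # 1 # Suc 1 # Suc (Suc m) # [2])"
    by (rule ear_sequence.ear)
  then have "ear_sequence ((?u @ [2, 1, 5]) @ 1 # 2 # [Suc (Suc m), 2])" by (simp add: eval_nat_numeral)
  then have "ear_sequence ((?u @ [2, 1, 5]) @ Suc 1 # 1 # Suc 2 # [Suc (Suc m), 2])"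
    by (rule ear_sequence.ear)
  then show ?case unfolding concat_replicate_Suc_right by (simp add: eval_nat_numeral)
qed

section \<open>Lower bounds in the poset\<close>

lemma pairs_le_iff:
  "O1 \<preceq> X \<longleftrightarrow> hits X 1 1 \<and> hits X 1 2 \<and> hits X 2 1 \<and> hits X 1 3"
  "O2 \<preceq> X \<longleftrightarrow> hits X 1 1 \<and> hits X 1 2 \<and> hits X 2 2 \<and> hits X 1 3 \<and> hits X 1 4"
  "O3 \<preceq> X \<longleftrightarrow> hits X 1 1 \<and> hits X 1 2 \<and> hits X 2 2 \<and> hits X 1 3 \<and> hits X 4 1 \<and> hits X 4 2"
  "O4 \<preceq> X \<longleftrightarrow> hits X 1 1 \<and> hits X 1 2 \<and> hits X 2 2 \<and> hits X 3 1 \<and> hits X 3 2 \<and> hits X 4 1 \<and> hits X 4 2 \<and> hits X 1 5"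
  "O5 \<preceq> X \<longleftrightarrow> hits X 1 1 \<and> hits X 1 2 \<and> hits X 2 2 \<and> hits X 3 1 \<and> hits X 3 2 \<and> hits X 4 1 \<and> hits X 4 2 \<and> hits X 5 2"
  "O6 \<preceq> X \<longleftrightarrow> hits X 1 1 \<and> hits X 1 2 \<and> hits X 2 2 \<and> hits X 3 1 \<and> hits X 3 2 \<and> hits X 1 4 \<and> hits X 4 2 \<and> hits X 1 5"
  "O7 \<preceq> X \<longleftrightarrow> hits X 1 1 \<and> hits X 1 2 \<and> hits X 2 2 \<and> hits X 3 1 \<and> hits X 3 2 \<and> hits X 1 4 \<and> hits X 4 2 \<and> hits X 5 2"
  "O8 \<preceq> X \<longleftrightarrow> hits X 1 1 \<and> hits X 1 2 \<and> hits X 2 2 \<and> hits X 3 1 \<and> hits X 3 2 \<and> hits X 1 4 \<and> hits X 3 4 \<and> hits X 1 5"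
  "O9 \<preceq> X \<longleftrightarrow> hits X 1 1 \<and> hits X 1 2 \<and> hits X 2 2 \<and> hits X 3 1 \<and> hits X 3 2 \<and> hits X 1 4 \<and> hits X 3 4 \<and> hits X 5 2"
  by (simp_all add: unavoidable_le_def hits_def O1_def O2_def O3_def O4_def O5_def O6_def O7_def O8_def O9_def)

lemma hits_reversal: "hits (reversal X) c d \<longleftrightarrow> hits X d c"
  unfolding hits_def sublist_reversal by simp

lemma hits_always:
  assumes X: "unavoidable_set X" "\<forall>x\<in>X. length x \<le> 2"
  shows "hits X 1 1" "hits X 1 2 \<or> hits X 2 1" "hits X 1 3 \<or> hits X 3 1"
  using unavoidable_hits[OF X, of "[1, 1]" 1] unavoidable_hits[OF X, of "[1, 2, 1]" 2]
    unavoidable_hits[OF X, of "[1, 3, 1, 3, 1]" 3] ear_sequences_small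
  by auto

lemma hits_if_not_hits_2_1:
  assumes X: "unavoidable_set X" "\<forall>x\<in>X. length x \<le> 2" and 21: "\<not> hits X 2 1"
  shows "hits X 2 2" "hits X 1 4 \<or> hits X 4 1" "hits X 1 4 \<or> hits X 4 2"
proof -
  obtain K where K: "\<And>a b c. hits X a (Suc K) \<Longrightarrow> hits X b a \<and> hits X a c"
    "\<And>a b c. hits X (Suc K) a \<Longrightarrow> hits X b a \<and> hits X a c"
    using hits_large[OF X(1)] by blast
  show "hits X 2 2"
  proof (rule ccontr)
    assume "\<not> hits X 2 2"
    \<comment> \<open>A hit on \<open>(1, Suc K)\<close> would come from the word
      \<open>[1]\<close>, which also hits \<open>(2, 1)\<close>.\<close>
    then have "successively (\<lambda>c d. \<not> hits X c d) (replicate m 2 @ [1, Suc K])" for m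
      using 21 K(1)[of 1 2] by (induction m) (auto simp: successively_Cons hd_append)
    then show False using unavoidable_hits[OF X, of "replicate K 2 @ [1, Suc K]" 1] ear_sequence_fan[of K] by simp
  qed
  show "hits X 1 4 \<or> hits X 4 1"
  proof (rule ccontr)
    assume "\<not> ?thesis"
    \<comment> \<open>The leading \<open>1\<close> comes from \<open>[Suc K, 2, 1]\<close> and lets
      the induction cover the pair \<open>(1, 4)\<close> at the seam.\<close>
    then have "successively (\<lambda>c d. \<not> hits X c d) (1 # concat (replicate m [4, 1]))" for m
      by (induction m) auto
    moreover have "\<not> hits X (Suc K) 2" using 21 K(2) by blast
    ultimately show False
      using 21 unavoidable_hits[OF X, of "[Suc K, 2, 1] @ concat (replicate K [4, 1])" 2] ear_sequence_4_1[of K]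
      by simp
  qed
  show "hits X 1 4 \<or> hits X 4 2"
    using 21 unavoidable_hits[OF X, of "[2, 1, 4, 2, 1, 4, 2, 1]" 4] ear_sequences_small(6) by auto
qed

lemma hits_if_not_hits_2_1_1_3:
  assumes X: "unavoidable_set X" "\<forall>x\<in>X. length x \<le> 2" and "\<not> hits X 2 1" "\<not> hits X 1 3"
  shows "hits X 3 2" "hits X 3 4 \<or> hits X 4 2" "hits X 1 5 \<or> hits X 5 2"
proof -
  show "hits X 3 2"
  proof (rule ccontr)
    assume "\<not> ?thesis"
    then have "successively (\<lambda>c d. \<not> hits X c d) [2, 1, 3, 2, 1]" using assms(3,4) by simp
    then show False using unavoidable_hits[OF X] ear_sequences_small(5) append.simps by metis
  qed
  show "hits X 3 4 \<or> hits X 4 2"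
  proof (rule ccontr)
    assume "\<not> ?thesis"
    then have "successively (\<lambda>c d. \<not> hits X c d) [2, 1, 3, 4, 2, 1, 3, 4, 2, 1, 3]" using assms(3,4) by simp
    then show False using unavoidable_hits[OF X] ear_sequences_small(7) append.simps by metis
  qed
  obtain K where K: "\<And>a b c. hits X a (Suc K) \<Longrightarrow> hits X b a \<and> hits X a c"
    "\<And>a b c. hits X (Suc K) a \<Longrightarrow> hits X b a \<and> hits X a c"
    using hits_large[OF X(1)] by blast
  show "hits X 1 5 \<or> hits X 5 2"
  proof (rule ccontr)
    assume *: "\<not> ?thesis"
    have "\<not> hits X 3 (Suc K)" using K(1) assms(4) by blast
    \<comment> \<open>The extra \<open>5\<close> in front makes the induction cover the pair
      \<open>(5, 2)\<close>; it is dropped afterwards.\<close>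
    then have "successively (\<lambda>c d. \<not> hits X c d) (5 # concat (replicate m [2, 1, 5]) @ [2, 1, 3, Suc K])" for m
      using * assms(3,4) by (induction m) auto
    then have "successively (\<lambda>c d. \<not> hits X c d) (concat (replicate K [2, 1, 5]) @ [2, 1, 3, Suc K])"
      by (simp add: successively_Cons)
    then show False
      using unavoidable_hits[OF X, of "concat (replicate K [2, 1, 5]) @ [2, 1, 3, Suc K]" 2]
        ear_sequence_2_1_5[of K] by simp
  qed
qed

text \<open>If \<open>(1, 3)\<close> is hit, the alternatives for the letter 4 leave
  \<open>O2\<close> and \<open>O3\<close>. Otherwise they leave three choices,
  \<open>(4, 1), (4, 2)\<close> or \<open>(1, 4), (4, 2)\<close> or \<open>(1, 4), (3, 4)\<close>;
  each combines with \<open>(1, 5)\<close> or \<open>(5, 2)\<close>, giving \<open>O4\<close> to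
  \<open>O9\<close>.\<close>

lemma pairs_le_if_not_hits_2_1:
  assumes X: "unavoidable_set X" "\<forall>x\<in>X. length x \<le> 2" and 21: "\<not> hits X 2 1"
  shows "\<exists>Z\<in>{O2, O3, O4, O5, O6, O7, O8, O9}. Z \<preceq> X"
proof (cases "hits X 1 3")
  case True
  then show ?thesis
    using hits_always[OF X] hits_if_not_hits_2_1[OF X 21] 21 by (auto simp: pairs_le_iff simp del: One_nat_def)
next
  case False
  then show ?thesis
    using hits_always[OF X] hits_if_not_hits_2_1[OF X 21] hits_if_not_hits_2_1_1_3[OF X 21] 21
    by (auto simp: pairs_le_iff simp del: One_nat_def)
qed

definition listed_sets :: "nat list set set" where
  "listed_sets = {O1, O2, O3, O4, O5, O6, O7, O8, O9}"

lemma unavoidable_above_listed: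
  assumes X: "unavoidable_set X" "\<forall>x\<in>X. length x \<le> 2"
  shows "\<exists>Z\<in>listed_sets \<union> reversal ` listed_sets. Z \<preceq> X"
proof -
  have rX: "unavoidable_set (reversal X)" "\<forall>x\<in>reversal X. length x \<le> 2"
    using X unavoidable_set_reversal by (auto simp: reversal_def)
  consider "\<not> hits X 2 1" | "\<not> hits X 1 2" | "hits X 1 2" "hits X 2 1" by blast
  then show ?thesis
  proof cases
    case 1
    then show ?thesis using pairs_le_if_not_hits_2_1[OF X] by (auto simp: listed_sets_def)
  next
    case 2
    then have "\<exists>Z\<in>{O2, O3, O4, O5, O6, O7, O8, O9}. Z \<preceq> reversal X"
      using pairs_le_if_not_hits_2_1[OF rX] by (simp add: hits_reversal)
    then show ?thesis by (auto simp: reversal_le_iff listed_sets_def)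
  next
    case 3
    \<comment> \<open>With both orders of 1 and 2 hit, \<open>O1\<close> or its reversal applies
      according to whether \<open>(1, 3)\<close> or \<open>(3, 1)\<close> is hit.\<close>
    then have "O1 \<preceq> X \<or> O1 \<preceq> reversal X"
      using hits_always[OF X] by (simp add: pairs_le_iff hits_reversal)
    then show ?thesis by (auto simp: reversal_le_iff listed_sets_def)
  qed
qed

section \<open>Minimality\<close>

lemma length_le_set_length: "finite X \<Longrightarrow> x \<in> X \<Longrightarrow> length x \<le> set_length X"
  unfolding set_length_def by (intro cSUP_upper bdd_above_finite finite_imageI)

lemma set_length_uniform:
  assumes "X \<noteq> {}" "\<forall>x\<in>X. length x = n"
  shows "set_length X = n"
proof -
  have "length ` X = {n}" using assms by auto
  then show ?thesis by (simp add: set_length_def)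
qed

lemma listed_properties:
  assumes "Z \<in> listed_sets \<union> reversal ` listed_sets"
  shows "unavoidable_set Z" "\<forall>x\<in>Z. length x = 2" "set_length Z = 2"
proof -
  have unav: "unavoidable_set W" if "W \<in> listed_sets" for W
    using that unavoidable_O1 unavoidable_O2 unavoidable_O3 unavoidable_O4 unavoidable_O5
      unavoidable_O6 unavoidable_O7 unavoidable_O8 unavoidable_O9
    by (auto simp: listed_sets_def)
  have pairs: "W \<noteq> {} \<and> (\<forall>x\<in>W. length x = 2)" if "W \<in> listed_sets" for W
    using that unfolding listed_sets_def
    by (elim insertE emptyE)
      (simp_all add: O1_def O2_def O3_def O4_def O5_def O6_def O7_def O8_def O9_def)
  show "unavoidable_set Z" using assms unav unavoidable_set_reversal by blast
  have "Z \<noteq> {} \<and> (\<forall>x\<in>Z. length x = 2)"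
    using assms pairs by (auto simp: reversal_def)
  then show "\<forall>x\<in>Z. length x = 2" "set_length Z = 2" using set_length_uniform by auto
qed

text \<open>All words here have length two, so inclusion is the same as \<open>\<preceq>\<close>
  between listed sets.\<close>

lemma listed_antichain:
  assumes "Y \<in> listed_sets \<union> reversal ` listed_sets" "Z \<in> listed_sets \<union> reversal ` listed_sets" "Y \<subseteq> Z"
  shows "Y = Z"
proof -
  have "\<forall>Y\<in>listed_sets \<union> reversal ` listed_sets. \<forall>Z\<in>listed_sets \<union> reversal ` listed_sets. Y \<subseteq> Z \<longrightarrow> Y = Z"
    by (simp add: listed_sets_def reversal_def O1_def O2_def O3_def O4_def O5_def O6_def O7_def O8_def O9_def)
  then show ?thesis using assms by blast
qed

lemma unavoidable_le_trans: "X \<preceq> Y \<Longrightarrow> Y \<preceq> Z \<Longrightarrow> X \<preceq> Z"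
  unfolding unavoidable_le_def by (meson sublist_order.order_trans)

text \<open>Passing from \<open>x\<close> to a subword in \<open>Y\<close> and on to a subword in
  \<open>X\<close> must return to \<open>x\<close>, as \<open>X\<close> has no redundancy.\<close>

lemma unavoidable_le_subset:
  assumes "X \<preceq> Y" "Y \<preceq> X" "without_redundancy X"
  shows "X \<subseteq> Y"
proof
  fix x assume "x \<in> X"
  then obtain y where y: "y \<in> Y" "sublist y x" using assms(1) by (auto simp: unavoidable_le_def)
  then obtain x' where x': "x' \<in> X" "sublist x' y" using assms(2) by (auto simp: unavoidable_le_def)
  then have "x' = x"
    using assms(3) \<open>x \<in> X\<close> y unfolding without_redundancy_def by (meson sublist_order.order_trans)
  then have "y = x" using x' y by (auto intro: sublist_order.order_antisym)
  then show "x \<in> Y" using y by simp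
qed

lemma unavoidable_le_antisym:
  assumes "X \<preceq> Y" "Y \<preceq> X" "without_redundancy X" "without_redundancy Y"
  shows "X = Y"
  using unavoidable_le_subset assms by blast

text \<open>A minimal set equals the listed set below it, which competes with it as an unavoidable
  set of length two. Conversely, anything below a listed set lies above another listed set, and the
  antichain property makes all three equal.\<close>

lemma minimal_unavoidable_sets_eq:
  "{X. minimal_unavoidable_set 2 X} = listed_sets \<union> reversal ` listed_sets"
proof (intro equalityI subsetI)
  fix X assume "X \<in> {X. minimal_unavoidable_set 2 X}"
  then have X: "unavoidable_set X" "set_length X = 2"
    and min: "\<And>Y. unavoidable_set Y \<Longrightarrow> set_length Y = 2 \<Longrightarrow> Y \<preceq> X \<Longrightarrow> Y = X"
    by (auto simp: minimal_unavoidable_set_def)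
  have "\<forall>x\<in>X. length x \<le> 2" using X length_le_set_length by (metis unavoidable_set_def)
  then obtain Z where Z: "Z \<in> listed_sets \<union> reversal ` listed_sets" "Z \<preceq> X"
    using unavoidable_above_listed X(1) by blast
  have "Z = X" by (rule min[OF listed_properties(1,3)[OF Z(1)] Z(2)])
  then show "X \<in> listed_sets \<union> reversal ` listed_sets" using Z(1) by simp
next
  fix X assume X: "X \<in> listed_sets \<union> reversal ` listed_sets"
  have "Y = X" if Y: "unavoidable_set Y" "set_length Y = 2" "Y \<preceq> X" for Y
  proof -
    have "\<forall>y\<in>Y. length y \<le> 2" using Y length_le_set_length by (metis unavoidable_set_def)
    then obtain Z where Z: "Z \<in> listed_sets \<union> reversal ` listed_sets" "Z \<preceq> Y"
      using unavoidable_above_listed Y(1) by blast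
    have "Z \<preceq> X" using Z(2) Y(3) by (rule unavoidable_le_trans)
    then have "Z \<subseteq> X"
      using sublist_same_length_eq listed_properties(2)[OF X] listed_properties(2)[OF Z(1)]
      unfolding unavoidable_le_def by (metis subsetI)
    then have "Z = X" by (rule listed_antichain[OF Z(1) X])
    then show ?thesis
      using unavoidable_le_antisym Y Z(2) listed_properties(1)[OF X]
      unfolding unavoidable_set_def by blast
  qed
  then show "X \<in> {X. minimal_unavoidable_set 2 X}"
    using listed_properties[OF X] by (auto simp: minimal_unavoidable_set_def)
qed

theorem corollaryC:
  "{X. minimal_unavoidable_set 2 X} =
     {O1, O2, O3, O4, O5, O6, O7, O8, O9} \<union>
     reversal ` {O1, O2, O3, O4, O5, O6, O7, O8, O9}"
  using minimal_unavoidable_sets_eq unfolding listed_sets_def .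

end
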